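(* Suppose that $\mathbf{P}\in\mathbb{P}\mathrm{iez}$ has no order two symmetry, and consider the equation $$\mathbf{r}\left(\mathbf{n},\tfrac{2\pi}{3}\right)\star\mathbf{P}=\mathbf{P}$$ with unknown a unit vector $\mathbf{n}=(n_1,n_2,n_3)\in\mathbb{R}^3$. If this equation has a solution, then the symmetry class of $\mathbf{P}$ is $[\mathbb{Z}_3]$; otherwise it is $[\mathbb{1}]$.
   Context: $\mathbb{P}\mathrm{iez}$ is the real vector space of piezoelectricity tensors $\{\mathbf{P}\in\otimes^3(\mathbb{R}^3): P_{ijk}=P_{ikj}\}$ (components in an orthonormal basis). The group $\mathrm{O}(3)$ acts on it by $(g\star\mathbf{P})_{ijk}=g_{ip}g_{jq}g_{kr}P_{pqr}$ (summation over repeated indices). The symmetry group of $\mathbf{P}$ is $G_{\mathbf{P}}=\{g\in\mathrm{O}(3): g\star\mathbf{P}=\mathbf{P}\}$, and its symmetry class is the conjugacy class $[G_{\mathbf{P}}]=\{gG_{\mathbf{P}}g^{-1}: g\in\mathrm{O}(3)\}$. For a subgroup $H$, $[H]$ denotes its conjugacy class in $\mathrm{O}(3)$. For a unit vector $\mathbf{n}$, $\mathbf{r}(\mathbf{n},\theta)$ is the rotation of angle $\theta$ about the axis generated by $\mathbf{n}$, and $\mathbf{s}(\mathbf{n})=-\mathbf{r}(\mathbf{n},\pi)$ is the reflection through the plane orthogonal to $\mathbf{n}$. An order two symmetry of $\mathbf{P}$ is an element $g$ of the form $\mathbf{r}(\mathbf{n},\pi)$ (axial symmetry) or $\mathbf{s}(\mathbf{n})$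 (plane symmetry) with $g\star\mathbf{P}=\mathbf{P}$. With $\mathbf{e}_3$ the third canonical basis vector, $\mathbb{Z}_3$ is the group generated by $\mathbf{r}(\mathbf{e}_3,2\pi/3)$, and $\mathbb{1}$ is the trivial group. *)

theory Defs
  imports "HOL-Analysis.Analysis" "HOL-Algebra.Coset" "HOL-Algebra.Generated_Groups"
begin

definition piez :: "(real^3^3^3) set" where
  "piez = {P. \<forall>i j k. P $ i $ j $ k = P $ i $ k $ j}"

definition O3 :: "(real^3^3) monoid" where
  "O3 = \<lparr>carrier = {g. orthogonal_matrix g}, monoid.mult = (**), one = mat 1\<rparr>"

lemma group_O3: "group O3"
proof (rule groupI)
  fix g assume "g \<in> carrier O3"
  then show "\<exists>h\<in>carrier O3. h \<otimes>\<^bsub>O3\<^esub> g = \<one>\<^bsub>O3\<^esub>"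
    by (intro bexI[of _ "transpose g"]) (auto simp: O3_def orthogonal_matrix_def)
qed (auto simp: O3_def orthogonal_matrix_mul orthogonal_matrix_id matrix_mul_assoc)

definition tensor_act :: "real^3^3 \<Rightarrow> real^3^3^3 \<Rightarrow> real^3^3^3" where
  "tensor_act g P = (\<chi> i j k. \<Sum>p\<in>UNIV. \<Sum>q\<in>UNIV. \<Sum>r\<in>UNIV.
     g $ i $ p * g $ j $ q * g $ k $ r * P $ p $ q $ r)"

definition symmetry_group :: "real^3^3^3 \<Rightarrow> (real^3^3) set" where
  "symmetry_group P = {g \<in> carrier O3. tensor_act g P = P}"

definition conj_class :: "(real^3^3) set \<Rightarrow> (real^3^3) set set" where
  "conj_class H = (\<lambda>g. g <#\<^bsub>O3\<^esub> (H #>\<^bsub>O3\<^esub> inv\<^bsub>O3\<^esub> g)) ` carrier O3"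

definition symmetry_class :: "real^3^3^3 \<Rightarrow> (real^3^3) set set" where
  "symmetry_class P = conj_class (symmetry_group P)"

(* Matrix of the rotation of angle \<theta> about a unit vector n (Rodrigues' formula),
   counterclockwise when seen from the tip of n; meaningful only if norm n = 1. *)
definition rot :: "real^3 \<Rightarrow> real \<Rightarrow> real^3^3" where
  "rot n \<theta> = matrix (\<lambda>v. cos \<theta> *\<^sub>R v + sin \<theta> *\<^sub>R cross3 n v + ((1 - cos \<theta>) * (n \<bullet> v)) *\<^sub>R n)"

lemma rot_e3:
  "rot (axis 3 1) \<theta> = vector [vector [cos \<theta>, - sin \<theta>, 0], vector [sin \<theta>, cos \<theta>, 0], vector [0, 0, 1]]"
  by (simp add: rot_def matrix_def vec_eq_iff forall_3 cross3_def axis_def inner_vec_def sum_3)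

definition plane_reflection :: "real^3 \<Rightarrow> real^3^3" where
  "plane_reflection n = - rot n pi"

definition order_two_symmetry :: "real^3^3 \<Rightarrow> real^3^3^3 \<Rightarrow> bool" where
  "order_two_symmetry g P \<longleftrightarrow>
     (\<exists>n. norm n = 1 \<and> (g = rot n pi \<or> g = plane_reflection n)) \<and> tensor_act g P = P"

definition Z3 :: "(real^3^3) set" where
  "Z3 = generate O3 {rot (axis 3 1) (2 * pi / 3)}"

end

theory Submission
  imports Defs
begin

text \<open>
  If a rotation about \<open>n\<close> of angle \<open>\<theta>\<close> fixes \<open>P\<close> and \<open>cos \<theta>\<close> is neither \<open>1\<close> nor \<open>-1/2\<close>, then
  \<open>e\<^sup>i\<^sup>\<theta>\<close> and \<open>e\<^sup>3\<^sup>i\<^sup>\<theta>\<close> differ from \<open>1\<close>, so the components of \<open>P\<close> of odd weight under the rotations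
  about \<open>n\<close> vanish and the half-turn about \<open>n\<close> fixes \<open>P\<close>. Without order two symmetries, the rotations
  fixing \<open>P\<close> therefore have order 1 or 3. An improper symmetry \<open>g\<close> has a square of order 1 or 3, so
  \<open>g\<^sup>3\<close> is an improper involution: a reflection, which is excluded, or \<open>-1\<close>, which forces
  \<open>P = 0\<close>. Finally, two rotations of order 3 about different axes with unit vectors \<open>n\<close>, \<open>m\<close> cannot
  both fix \<open>P\<close>: the traces of their product and of the product of one with the inverse of the other
  lie in \<open>{0, 3}\<close>, which requires the inner product of \<open>n\<close> and \<open>m\<close> to be \<open>\<plusminus>1\<close>.
\<close>

section \<open>The action of matrices on third-order tensors\<close>

lemma tensor_act_nth: "tensor_act A P $ i $ j $ k =
    (\<Sum>p\<in>UNIV. A $ i $ p * (\<Sum>q\<in>UNIV. A $ j $ q * (\<Sum>r\<in>UNIV. A $ k $ r * P $ p $ q $ r)))"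
  by (simp add: tensor_act_def sum_distrib_left mult.assoc)

lemma tensor_act_mat1: "tensor_act (mat 1) P = P"
  by (simp add: tensor_act_def mat_def vec_eq_iff sum_3 forall_3)

lemma tensor_act_uminus: "tensor_act (- A) P = - tensor_act A P"
  by (simp add: tensor_act_def vec_eq_iff sum_negf)

lemma sum_mult_swap:
  fixes x :: "'a \<Rightarrow> real"
  shows "(\<Sum>q\<in>I. x q * (\<Sum>c\<in>J. y c * z q c)) = (\<Sum>c\<in>J. y c * (\<Sum>q\<in>I. x q * z q c))"
  unfolding sum_distrib_left by (subst sum.swap) (simp add: mult.left_commute)

lemma tensor_act_mul: "tensor_act (A ** B) P = tensor_act A (tensor_act B P)"
proof -
  have M: "(\<Sum>p\<in>UNIV. (A ** B) $ i $ p * X p) = (\<Sum>a\<in>UNIV. A $ i $ a * (\<Sum>p\<in>UNIV. B $ a $ p * X p))" for i X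
    unfolding matrix_matrix_mult_def
    by (simp add: sum_distrib_left sum_distrib_right mult.assoc) (rule sum.swap)
  have "tensor_act (A ** B) P $ i $ j $ k = tensor_act A (tensor_act B P) $ i $ j $ k" for i j k
    unfolding tensor_act_nth M
    \<comment> \<open>The two sides differ only in the order in which the sums with coefficients
      from \<open>A\<close> and from \<open>B\<close> are nested; three exchanges of adjacent sums
      align them.\<close>
    by (subst (3) sum_mult_swap, subst (2) sum_mult_swap, subst (3) sum_mult_swap) (rule refl)
  then show ?thesis by (simp add: vec_eq_iff)
qed

lemma tensor_act_transpose_cancel:
  assumes "orthogonal_matrix g"
  shows "tensor_act (transpose g) (tensor_act g P) = P" "tensor_act g (tensor_act (transpose g) P) = P"
  using assms by (simp_all add: orthogonal_matrix_def tensor_act_mat1 flip: tensor_act_mul)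

text \<open>Carries symmetries along when a tensor is moved by \<open>g\<close>: the action of
  \<open>g\<close> is injective and turns \<open>B\<close> into \<open>A\<close>. The hypothesis has
  the form supplied by \<open>rot_intertwine\<close>.\<close>

lemma tensor_act_intertwine:
  assumes "orthogonal_matrix g" "A ** g = g ** B"
  shows "tensor_act A (tensor_act g P) = tensor_act g P \<longleftrightarrow> tensor_act B P = P"
proof -
  have "tensor_act A (tensor_act g P) = tensor_act g (tensor_act B P)"
    by (simp add: assms(2) flip: tensor_act_mul)
  then show ?thesis by (metis tensor_act_transpose_cancel(1)[OF assms(1)])
qed

section \<open>Tensors fixed by a rotation about the third axis\<close>

text \<open>The plane rotation minus the identity has determinant (c - 1)^2 + s^2 = 2 - 2c, which is
  nonzero, so only the zero vector is fixed.\<close>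

lemma circle_action_fixed_eq_0:
  fixes a b c s :: real
  assumes "a = c * a - s * b" "b = s * a + c * b" "c\<^sup>2 + s\<^sup>2 = 1" "c \<noteq> 1"
  shows "a = 0 \<and> b = 0"
proof -
  have "(2 - 2 * c) * a = 0" "(2 - 2 * c) * b = 0" using assms(1-3) by algebra+
  then show ?thesis using assms(4) by auto
qed

text \<open>Real and imaginary parts of the contractions of the tensor with vectors
  \<open>(1, \<plusminus>\<i>)\<close>, on which the rotation acts by \<open>e\<^sup>\<plusminus>\<^sup>i\<^sup>\<theta>\<close> or \<open>e\<^sup>\<plusminus>\<^sup>3\<^sup>i\<^sup>\<theta>\<close>, where
  \<open>c + i s = e\<^sup>i\<^sup>\<theta>\<close>.\<close>

lemma circle_action_on_cubic_tensor:
  fixes c s :: real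
  assumes cs: "c\<^sup>2 + s\<^sup>2 = 1"
    and y:
    "y111 = c * (c * (c * x111 - s * x112) - s * (c * x121 - s * x122)) - s * (c * (c * x211 - s * x212) - s * (c * x221 - s * x222))"
    "y112 = c * (c * (s * x111 + c * x112) - s * (s * x121 + c * x122)) - s * (c * (s * x211 + c * x212) - s * (s * x221 + c * x222))"
    "y121 = c * (s * (c * x111 - s * x112) + c * (c * x121 - s * x122)) - s * (s * (c * x211 - s * x212) + c * (c * x221 - s * x222))"
    "y122 = c * (s * (s * x111 + c * x112) + c * (s * x121 + c * x122)) - s * (s * (s * x211 + c * x212) + c * (s * x221 + c * x222))"
    "y211 = s * (c * (c * x111 - s * x112) - s * (c * x121 - s * x122)) + c * (c * (c * x211 - s * x212) - s * (c * x221 - s * x222))"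
    "y212 = s * (c * (s * x111 + c * x112) - s * (s * x121 + c * x122)) + c * (c * (s * x211 + c * x212) - s * (s * x221 + c * x222))"
    "y221 = s * (s * (c * x111 - s * x112) + c * (c * x121 - s * x122)) + c * (s * (c * x211 - s * x212) + c * (c * x221 - s * x222))"
    "y222 = s * (s * (s * x111 + c * x112) + c * (s * x121 + c * x122)) + c * (s * (s * x211 + c * x212) + c * (s * x221 + c * x222))"
  shows
    "y111 - y122 - y212 - y221 = (c ^ 3 - 3 * c * s\<^sup>2) * (x111 - x122 - x212 - x221) - (3 * c\<^sup>2 * s - s ^ 3) * (x112 + x121 + x211 - x222)"
    "y112 + y121 + y211 - y222 = (3 * c\<^sup>2 * s - s ^ 3) * (x111 - x122 - x212 - x221) + (c ^ 3 - 3 * c * s\<^sup>2) * (x112 + x121 + x211 - x222)"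
    "y111 + y122 + y212 - y221 = c * (x111 + x122 + x212 - x221) - s * (x222 + x211 + x121 - x112)"
    "y222 + y211 + y121 - y112 = s * (x111 + x122 + x212 - x221) + c * (x222 + x211 + x121 - x112)"
    "y111 + y122 - y212 + y221 = c * (x111 + x122 - x212 + x221) - s * (x222 + x211 - x121 + x112)"
    "y222 + y211 - y121 + y112 = s * (x111 + x122 - x212 + x221) + c * (x222 + x211 - x121 + x112)"
    "y111 - y122 + y212 + y221 = c * (x111 - x122 + x212 + x221) - s * (x222 - x211 + x121 + x112)"
    "y222 - y211 + y121 + y112 = s * (x111 - x122 + x212 + x221) + c * (x222 - x211 + x121 + x112)"
proof -
  show "y111 - y122 - y212 - y221 = (c ^ 3 - 3 * c * s\<^sup>2) * (x111 - x122 - x212 - x221) - (3 * c\<^sup>2 * s - s ^ 3) * (x112 + x121 + x211 - x222)"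
    unfolding y by algebra
  show "y112 + y121 + y211 - y222 = (3 * c\<^sup>2 * s - s ^ 3) * (x111 - x122 - x212 - x221) + (c ^ 3 - 3 * c * s\<^sup>2) * (x112 + x121 + x211 - x222)"
    unfolding y by algebra
  \<comment> \<open>In weight one a factor e^(i\<theta>) meets its conjugate. Keeping their product
    c^2 + s^2 explicit makes these unconditional polynomial identities.\<close>
  have "y111 + y122 + y212 - y221 = (c\<^sup>2 + s\<^sup>2) * (c * (x111 + x122 + x212 - x221) - s * (x222 + x211 + x121 - x112))"
    "y222 + y211 + y121 - y112 = (c\<^sup>2 + s\<^sup>2) * (s * (x111 + x122 + x212 - x221) + c * (x222 + x211 + x121 - x112))"
    "y111 + y122 - y212 + y221 = (c\<^sup>2 + s\<^sup>2) * (c * (x111 + x122 - x212 + x221) - s * (x222 + x211 - x121 + x112))"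
    "y222 + y211 - y121 + y112 = (c\<^sup>2 + s\<^sup>2) * (s * (x111 + x122 - x212 + x221) + c * (x222 + x211 - x121 + x112))"
    "y111 - y122 + y212 + y221 = (c\<^sup>2 + s\<^sup>2) * (c * (x111 - x122 + x212 + x221) - s * (x222 - x211 + x121 + x112))"
    "y222 - y211 + y121 + y112 = (c\<^sup>2 + s\<^sup>2) * (s * (x111 - x122 + x212 + x221) + c * (x222 - x211 + x121 + x112))"
    unfolding y by algebra+
  note h = this[unfolded cs mult_1]
  show
    "y111 + y122 + y212 - y221 = c * (x111 + x122 + x212 - x221) - s * (x222 + x211 + x121 - x112)"
    "y222 + y211 + y121 - y112 = s * (x111 + x122 + x212 - x221) + c * (x222 + x211 + x121 - x112)"
    "y111 + y122 - y212 + y221 = c * (x111 + x122 - x212 + x221) - s * (x222 + x211 - x121 + x112)"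
    "y222 + y211 - y121 + y112 = s * (x111 + x122 - x212 + x221) + c * (x222 + x211 - x121 + x112)"
    "y111 - y122 + y212 + y221 = c * (x111 - x122 + x212 + x221) - s * (x222 - x211 + x121 + x112)"
    "y222 - y211 + y121 + y112 = s * (x111 - x122 + x212 + x221) + c * (x222 - x211 + x121 + x112)"
    by (rule h)+
qed

lemma rot_e3_pi_fixes:
  assumes fP: "tensor_act (rot (axis 3 1) \<theta>) P = P"
    and ne: "cos \<theta> \<noteq> 1" "cos \<theta> \<noteq> -1/2"
  shows "tensor_act (rot (axis 3 1) pi) P = P"
proof -
  define c where "c = cos \<theta>"
  define s where "s = sin \<theta>"
  have cs: "c\<^sup>2 + s\<^sup>2 = 1" by (simp add: c_def s_def)
  have c1: "c \<noteq> 1" using ne by (simp add: c_def)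
  have c3: "c ^ 3 - 3 * c * s\<^sup>2 \<noteq> 1"
  proof
    assume "c ^ 3 - 3 * c * s\<^sup>2 = 1"
    \<comment> \<open>The left side of the assumption is cos 3\<theta> = 4c^3 - 3c, and 4c^3 - 3c -
      1 factors in this way; this is where the value -1/2 enters.\<close>
    then have "(c - 1) * (2 * c + 1)\<^sup>2 = 0" using cs by algebra
    then show False using ne by (auto simp: c_def)
  qed
  have cs3: "(c ^ 3 - 3 * c * s\<^sup>2)\<^sup>2 + (3 * c\<^sup>2 * s - s ^ 3)\<^sup>2 = 1"
  proof -
    have "(c ^ 3 - 3 * c * s\<^sup>2)\<^sup>2 + (3 * c\<^sup>2 * s - s ^ 3)\<^sup>2 = (c\<^sup>2 + s\<^sup>2) ^ 3" by algebra
    then show ?thesis by (simp add: cs)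
  qed
  note e = tensor_act_nth[of "rot (axis 3 1) \<theta>" P, unfolded fP, unfolded rot_e3, folded c_def s_def, unfolded sum_3]
  note isotypic = circle_action_on_cubic_tensor[OF cs e[of 1 1 1, simplified] e[of 1 1 2, simplified]
     e[of 1 2 1, simplified] e[of 1 2 2, simplified] e[of 2 1 1, simplified] e[of 2 1 2, simplified]
     e[of 2 2 1, simplified] e[of 2 2 2, simplified]]
  \<comment> \<open>With two indices equal to 3, the remaining index transforms like a vector of the
    plane, hence with weight one.\<close>
  have "P$1$3$3 = 0 \<and> P$2$3$3 = 0"
    using e[of 1 3 3] e[of 2 3 3] by (intro circle_action_fixed_eq_0[OF _ _ cs c1]) simp_all
  moreover have "P$3$1$3 = 0 \<and> P$3$2$3 = 0"
    using e[of 3 1 3] e[of 3 2 3] by (intro circle_action_fixed_eq_0[OF _ _ cs c1]) simp_all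
  moreover have "P$3$3$1 = 0 \<and> P$3$3$2 = 0"
    using e[of 3 3 1] e[of 3 3 2] by (intro circle_action_fixed_eq_0[OF _ _ cs c1]) simp_all
  moreover note circle_action_fixed_eq_0[OF isotypic(1,2) cs3 c3]
    circle_action_fixed_eq_0[OF isotypic(3,4) cs c1] circle_action_fixed_eq_0[OF isotypic(5,6) cs c1]
    circle_action_fixed_eq_0[OF isotypic(7,8) cs c1]
  \<comment> \<open>The four vanishing pairs from \<open>isotypic\<close> form an invertible linear
    system in the eight components with all indices in {1,2}.\<close>
  ultimately have
    "P$1$3$3 = 0" "P$2$3$3 = 0" "P$3$1$3 = 0" "P$3$2$3 = 0" "P$3$3$1 = 0" "P$3$3$2 = 0"
    "P$1$1$1 = 0" "P$1$1$2 = 0" "P$1$2$1 = 0" "P$1$2$2 = 0"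
    "P$2$1$1 = 0" "P$2$1$2 = 0" "P$2$2$1 = 0" "P$2$2$2 = 0"
    by linarith+
  \<comment> \<open>The half-turn is diag(-1,-1,1). It negates exactly the components with an odd
    number of indices in {1,2}, which are the fourteen just shown to vanish.\<close>
  then show ?thesis
    by (simp add: vec_eq_iff forall_3 tensor_act_nth sum_3 rot_e3)
qed

section \<open>Rotation matrices of three-space and Euler's theorem\<close>

lemma rot_mult_vec:
  "rot n \<theta> *v v = cos \<theta> *\<^sub>R v + sin \<theta> *\<^sub>R cross3 n v + ((1 - cos \<theta>) * (n \<bullet> v)) *\<^sub>R n"
proof -
  have "linear (\<lambda>v. cos \<theta> *\<^sub>R v + sin \<theta> *\<^sub>R cross3 n v + ((1 - cos \<theta>) * (n \<bullet> v)) *\<^sub>R n)"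
    by (rule linearI) (simp_all add: cross3_simps forall_3)
  then show ?thesis unfolding rot_def by (rule matrix_vector_mul(2)[THEN fun_cong])
qed

lemma rot_eq_vector:
  "rot n \<theta> = vector
    [vector [cos \<theta> + (1 - cos \<theta>) * n$1 * n$1, (1 - cos \<theta>) * n$1 * n$2 - sin \<theta> * n$3, (1 - cos \<theta>) * n$1 * n$3 + sin \<theta> * n$2],
     vector [(1 - cos \<theta>) * n$1 * n$2 + sin \<theta> * n$3, cos \<theta> + (1 - cos \<theta>) * n$2 * n$2, (1 - cos \<theta>) * n$2 * n$3 - sin \<theta> * n$1],
     vector [(1 - cos \<theta>) * n$1 * n$3 - sin \<theta> * n$2, (1 - cos \<theta>) * n$2 * n$3 + sin \<theta> * n$1, cos \<theta> + (1 - cos \<theta>) * n$3 * n$3]]"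
  by (simp add: rot_def matrix_def vec_eq_iff forall_3 cross3_def axis_def inner_vec_def sum_3)

lemma rot_eq_mat1: "cos \<theta> = 1 \<Longrightarrow> sin \<theta> = 0 \<Longrightarrow> rot n \<theta> = mat 1"
  by (simp add: rot_eq_vector vec_eq_iff forall_3 mat_def)

lemma rot_uminus: "rot (- n) \<theta> = rot n (- \<theta>)"
  by (simp add: rot_eq_vector)

lemma transpose_rot: "transpose (rot n \<theta>) = rot n (- \<theta>)"
  by (simp add: rot_eq_vector transpose_def vec_eq_iff forall_3)

lemma rotation_matrixD:
  assumes "rotation_matrix g"
  shows "transpose g ** g = mat 1" "g ** transpose g = mat 1"
  using assms by (auto simp: rotation_matrix_def orthogonal_matrix_def)

text \<open>Rodrigues' formula is built from inner and cross products, and a proper rotation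
  preserves both.\<close>

lemma rot_intertwine:
  assumes g: "rotation_matrix g"
  shows "rot (g *v n) \<theta> ** g = g ** rot n \<theta>"
proof -
  have "(rot (g *v n) \<theta> ** g) *v w = (g ** rot n \<theta>) *v w" for w
  proof -
    have "orthogonal_transformation ((*v) g)"
      using g by (simp add: rotation_matrix_def orthogonal_transformation_matrix)
    then have i: "(g *v n) \<bullet> (g *v w) = n \<bullet> w"
      by (simp add: orthogonal_transformation_def)
    have "rot (g *v n) \<theta> *v (g *v w) = g *v (rot n \<theta> *v w)"
      unfolding rot_mult_vec i cross_rotation_matrix[OF g]
      by (simp add: matrix_vector_right_distrib matrix_vector_mult_scaleR)
    then show ?thesis by (simp only: matrix_vector_mul_assoc)
  qed
  then show ?thesis by (simp add: matrix_eq)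
qed

lemma rot_conj:
  assumes g: "rotation_matrix g"
  shows "rot (g *v n) \<theta> = g ** rot n \<theta> ** transpose g"
proof -
  have "rot (g *v n) \<theta> ** (g ** transpose g) = g ** rot n \<theta> ** transpose g"
    by (simp only: matrix_mul_assoc rot_intertwine[OF g])
  then show ?thesis by (simp only: rotation_matrixD[OF g] matrix_mul_rid)
qed

lemma rotation_to_axis:
  fixes n :: "real^3"
  assumes "norm n = 1"
  obtains g where "rotation_matrix g" "g *v axis 3 1 = n"
  using rotation_matrix_exists_basis[of n 3] assms by auto

text \<open>Conjugation moves the axis to \<open>axis 3 1\<close>, where the claim is the addition
  formulas for sine and cosine.\<close>

lemma rot_add:
  assumes "norm n = 1"
  shows "rot n a ** rot n b = rot n (a + b)"
proof -
  obtain g where g: "rotation_matrix g" "g *v axis 3 1 = n" using rotation_to_axis[OF assms] .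
  have "rot (axis 3 1) a ** rot (axis 3 1) b = rot (axis 3 1) (a + b)"
    by (simp add: rot_e3 vec_eq_iff forall_3 matrix_matrix_mult_def sum_3 cos_add sin_add)
  then have "(rot n a ** g) ** rot (axis 3 1) b ** transpose g = g ** rot (axis 3 1) (a + b) ** transpose g"
    using rot_intertwine[OF g(1), of "axis 3 1" a] by (simp only: g(2) flip: matrix_mul_assoc)
  then have "rot n a ** (g ** rot (axis 3 1) b ** transpose g) = g ** rot (axis 3 1) (a + b) ** transpose g"
    by (simp only: matrix_mul_assoc)
  then show ?thesis by (simp only: g(2) flip: rot_conj[OF g(1)])
qed

lemma orthogonal_rot: "norm n = 1 \<Longrightarrow> orthogonal_matrix (rot n \<theta>)"
  by (simp add: orthogonal_matrix_def transpose_rot rot_add rot_eq_mat1)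

lemma trace_rot: "norm n = 1 \<Longrightarrow> trace (rot n \<theta>) = 1 + 2 * cos \<theta>"
proof -
  assume "norm n = 1"
  then have "n$1 * n$1 + n$2 * n$2 + n$3 * n$3 = 1"
    by (simp add: norm_eq_1 inner_vec_def sum_3)
  moreover have "trace (rot n \<theta>) = 3 * cos \<theta> + (1 - cos \<theta>) * (n$1 * n$1 + n$2 * n$2 + n$3 * n$3)"
    by (simp add: trace_def sum_3 rot_eq_vector algebra_simps)
  ultimately show ?thesis by simp
qed

text \<open>With B = A - 1 and T for the transpose, A^T B = 1 - A^T = -B^T. Taking determinants in
  odd dimension gives det B = -det B, so B has a nonzero kernel vector, which is then
  normalised.\<close>

lemma rotation_matrix_fixes_axis:
  fixes A :: "real^3^3"
  assumes A: "rotation_matrix A"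
  obtains n where "norm n = 1" "A *v n = n"
proof -
  have o: "transpose A ** A = mat 1" and d: "det A = 1"
    using A by (auto simp: rotation_matrix_def orthogonal_matrix)
  have "transpose A ** (A - mat 1) = transpose A ** A - transpose A ** mat 1"
    by (simp add: vec_eq_iff matrix_matrix_mult_def sum_3 algebra_simps)
  also have "\<dots> = - transpose (A - mat 1)"
    unfolding o matrix_mul_rid by (simp add: transpose_def vec_eq_iff mat_def)
  finally have "det (transpose A ** (A - mat 1)) = det (- transpose (A - mat 1))"
    by simp
  then have "det (A - mat 1) = det (- transpose (A - mat 1))"
    by (simp add: det_mul d det_transpose)
  also have "\<dots> = - det (transpose (A - mat 1))"
    by (simp add: det_3 algebra_simps)
  finally have "det (A - mat 1) = 0" by (simp add: det_transpose)
  then have "\<not> invertible (A - mat 1)" by (simp add: invertible_det_nz)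
  then obtain x where x: "(A - mat 1) *v x = 0" "x \<noteq> 0"
    by (meson invertible_left_inverse matrix_left_invertible_ker)
  then have "A *v x = x" by (simp add: matrix_vector_mult_diff_rdistrib)
  then show ?thesis using x(2) that[of "x /\<^sub>R norm x"] by (simp add: matrix_vector_mult_scaleR)
qed

lemma rotation_fixing_e3:
  fixes B :: "real^3^3"
  assumes B: "rotation_matrix B" "B *v axis 3 1 = axis 3 1"
  obtains \<theta> where "B = rot (axis 3 1) \<theta>"
proof -
  have "(B *v axis 3 1) $ i = axis 3 1 $ i" for i using B(2) by simp
  from this[of 1] this[of 2] this[of 3] have col: "B$1$3 = 0" "B$2$3 = 0" "B$3$3 = 1"
    by (simp_all add: matrix_vector_mult_def sum_3 axis_def)
  have "(B ** transpose B) $ i $ j = mat 1 $ i $ j" for i j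
    using B(1) by (simp add: rotation_matrix_def orthogonal_matrix_def)
  from this[of 1 1] this[of 2 2] this[of 3 3] col have
    r: "B$1$1 * B$1$1 + B$1$2 * B$1$2 = 1" "B$2$1 * B$2$1 + B$2$2 * B$2$2 = 1" "B$3$1 * B$3$1 + B$3$2 * B$3$2 = 0"
    by (simp_all add: matrix_matrix_mult_def transpose_def sum_3 mat_def)
  from r(3) have row: "B$3$1 = 0" "B$3$2 = 0" by (simp_all add: sum_squares_eq_zero_iff)
  have "det B = 1" using B(1) by (simp add: rotation_matrix_def)
  then have d: "B$1$1 * B$2$2 - B$1$2 * B$2$1 = 1" by (simp add: det_3 col row)
  \<comment> \<open>The sum expands to the squared lengths of the two rows minus twice the
    determinant of the block: 1 + 1 - 2.\<close>
  have "(B$1$1 - B$2$2) * (B$1$1 - B$2$2) + (B$1$2 + B$2$1) * (B$1$2 + B$2$1) = 0"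
    using r(1,2) d by algebra
  then have eq: "B$2$2 = B$1$1" "B$1$2 = - B$2$1"
    unfolding sum_squares_eq_zero_iff by auto
  have "(B$1$1)\<^sup>2 + (B$2$1)\<^sup>2 = 1" using r(1) eq by (simp add: power2_eq_square)
  then obtain \<theta> where "B$1$1 = cos \<theta>" "B$2$1 = sin \<theta>" using sincos_total_2pi by metis
  then have "B = rot (axis 3 1) \<theta>" by (simp add: rot_e3 vec_eq_iff forall_3 col row eq)
  then show ?thesis by (rule that)
qed

lemma rotation_matrix_eq_rot:
  fixes A :: "real^3^3"
  assumes A: "rotation_matrix A"
  obtains n \<theta> where "norm n = 1" "A = rot n \<theta>"
proof -
  obtain n where n: "norm n = 1" "A *v n = n" using rotation_matrix_fixes_axis[OF A] .
  obtain g where g: "rotation_matrix g" "g *v axis 3 1 = n" using rotation_to_axis[OF n(1)] .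
  have o: "transpose g ** g = mat 1" "g ** transpose g = mat 1"
    using g by (auto simp: rotation_matrix_def orthogonal_matrix_def)
  define B where "B = transpose g ** A ** g"
  have "rotation_matrix B" using A g(1)
    by (simp add: B_def rotation_matrix_def orthogonal_matrix_mul det_mul det_transpose)
  moreover have "B *v axis 3 1 = axis 3 1"
  proof -
    have "B *v axis 3 1 = transpose g *v (A *v (g *v axis 3 1))"
      by (simp only: B_def matrix_vector_mul_assoc matrix_mul_assoc)
    also have "\<dots> = (transpose g ** g) *v axis 3 1"
      by (simp only: g(2) n(2) flip: matrix_vector_mul_assoc)
    finally show ?thesis by (simp only: o matrix_vector_mul_lid)
  qed
  ultimately obtain \<theta> where "B = rot (axis 3 1) \<theta>" by (rule rotation_fixing_e3)
  moreover have "A = g ** B ** transpose g"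
  proof -
    have "g ** B ** transpose g = (g ** transpose g) ** A ** (g ** transpose g)"
      by (simp only: B_def matrix_mul_assoc)
    then show ?thesis by (simp only: o matrix_mul_lid matrix_mul_rid)
  qed
  ultimately have "A = rot n \<theta>" using rot_conj[OF g(1)] g(2) by metis
  then show ?thesis using n(1) that by blast
qed

lemma rot_pi_fixes:
  assumes n: "norm n = 1" and fP: "tensor_act (rot n \<theta>) P = P"
    and ne: "cos \<theta> \<noteq> 1" "cos \<theta> \<noteq> -1/2"
  shows "tensor_act (rot n pi) P = P"
proof -
  obtain g where g: "rotation_matrix g" "g *v axis 3 1 = n" using rotation_to_axis[OF n] .
  then have o: "orthogonal_matrix g" by (simp add: rotation_matrix_def)
  define Q where "Q = tensor_act (transpose g) P"
  have P: "P = tensor_act g Q" by (simp add: Q_def tensor_act_transpose_cancel[OF o])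
  have "tensor_act (rot n t) P = P \<longleftrightarrow> tensor_act (rot (axis 3 1) t) Q = Q" for t
    using tensor_act_intertwine[OF o rot_intertwine[OF g(1), of "axis 3 1" t]] by (simp only: g(2) P)
  then show ?thesis using fP rot_e3_pi_fixes[OF _ ne] by blast
qed

section \<open>Conjugacy classes in O(3) and invariance of the symmetry class\<close>

lemma carrier_O3 [simp]: "g \<in> carrier O3 \<longleftrightarrow> orthogonal_matrix g"
  by (simp add: O3_def)

lemma mult_O3 [simp]: "g \<otimes>\<^bsub>O3\<^esub> h = g ** h"
  by (simp add: O3_def)

lemma one_O3 [simp]: "\<one>\<^bsub>O3\<^esub> = mat 1"
  by (simp add: O3_def)

lemma inv_O3: "orthogonal_matrix g \<Longrightarrow> inv\<^bsub>O3\<^esub> g = transpose g"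
  by (rule group.inv_equality[OF group_O3]) (auto simp: orthogonal_matrix_def)

lemma conj_class_eq:
  "conj_class H = (\<lambda>g. (\<lambda>x. g ** x ** transpose g) ` H) ` {g. orthogonal_matrix g}"
proof -
  have "g <#\<^bsub>O3\<^esub> (H #>\<^bsub>O3\<^esub> inv\<^bsub>O3\<^esub> g) = (\<lambda>x. g ** x ** transpose g) ` H"
    if "orthogonal_matrix g" for g
    using that by (auto simp: l_coset_def r_coset_def inv_O3 matrix_mul_assoc image_iff)
  moreover have "carrier O3 = {g. orthogonal_matrix g}" by (simp add: O3_def)
  ultimately show ?thesis unfolding conj_class_def by (metis (mono_tags, lifting) image_cong mem_Collect_eq)
qed

text \<open>Conjugating by \<open>h\<close> and then by \<open>g\<close> is conjugating by
  \<open>g ** h\<close>, and right translation by \<open>h\<close> maps O(3) onto itself.\<close>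

lemma conj_class_conj:
  assumes h: "orthogonal_matrix h"
  shows "conj_class ((\<lambda>x. h ** x ** transpose h) ` H) = conj_class H"
proof -
  define C where "C g = (\<lambda>x. g ** x ** transpose g) ` H" for g :: "real^3^3"
  have 1: "(\<lambda>x. g ** x ** transpose g) ` (\<lambda>x. h ** x ** transpose h) ` H = C (g ** h)" for g
    by (simp add: C_def image_image matrix_transpose_mul matrix_mul_assoc)
  have "C ` {g. orthogonal_matrix g} \<subseteq> (\<lambda>g. C (g ** h)) ` {g. orthogonal_matrix g}"
  proof
    fix X assume "X \<in> C ` {g. orthogonal_matrix g}"
    then obtain g where g: "orthogonal_matrix g" "X = C g" by auto
    have "(g ** transpose h) ** h = g"
      using h by (simp add: orthogonal_matrix_def flip: matrix_mul_assoc)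
    moreover have "orthogonal_matrix (g ** transpose h)"
      using g h by (simp add: orthogonal_matrix_mul)
    ultimately show "X \<in> (\<lambda>g. C (g ** h)) ` {g. orthogonal_matrix g}"
      using g(2) by (metis (mono_tags, lifting) imageI mem_Collect_eq)
  qed
  moreover have "(\<lambda>g. C (g ** h)) ` {g. orthogonal_matrix g} \<subseteq> C ` {g. orthogonal_matrix g}"
    using h by (auto simp: orthogonal_matrix_mul)
  ultimately show ?thesis unfolding conj_class_eq 1 by (simp add: C_def)
qed

lemma mem_symmetry_group:
  "g \<in> symmetry_group P \<longleftrightarrow> orthogonal_matrix g \<and> tensor_act g P = P"
  by (simp add: symmetry_group_def)

lemma subgroup_symmetry_group: "subgroup (symmetry_group P) O3"
proof (rule group.subgroupI[OF group_O3])
  show "symmetry_group P \<noteq> {}"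
    using orthogonal_matrix_id tensor_act_mat1 mem_symmetry_group by blast
  show "inv\<^bsub>O3\<^esub> g \<in> symmetry_group P" if "g \<in> symmetry_group P" for g
    using that tensor_act_transpose_cancel(1)[of g P] by (simp add: inv_O3 mem_symmetry_group)
qed (auto simp: mem_symmetry_group tensor_act_mul orthogonal_matrix_mul)

lemma symmetry_group_tensor_act:
  assumes h: "orthogonal_matrix h"
  shows "symmetry_group (tensor_act h P) = (\<lambda>x. h ** x ** transpose h) ` symmetry_group P"
proof (intro equalityI subsetI)
  fix g assume g: "g \<in> symmetry_group (tensor_act h P)"
  define x where "x = transpose h ** g ** h"
  have "h ** x ** transpose h = (h ** transpose h) ** g ** (h ** transpose h)"
    by (simp only: x_def matrix_mul_assoc)
  then have "g = h ** x ** transpose h"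
    using h by (simp add: orthogonal_matrix_def)
  moreover have "tensor_act x P = P"
    using g tensor_act_transpose_cancel(1)[OF h] by (simp add: x_def tensor_act_mul mem_symmetry_group)
  then have "x \<in> symmetry_group P"
    using g h by (simp add: x_def mem_symmetry_group orthogonal_matrix_mul)
  ultimately show "g \<in> (\<lambda>x. h ** x ** transpose h) ` symmetry_group P" by blast
next
  fix g assume "g \<in> (\<lambda>x. h ** x ** transpose h) ` symmetry_group P"
  then show "g \<in> symmetry_group (tensor_act h P)"
    using h tensor_act_transpose_cancel(1)[OF h]
    by (auto simp: mem_symmetry_group orthogonal_matrix_mul tensor_act_mul)
qed

lemma symmetry_class_tensor_act:
  "orthogonal_matrix h \<Longrightarrow> symmetry_class (tensor_act h P) = symmetry_class P"
  by (simp add: symmetry_class_def symmetry_group_tensor_act conj_class_conj)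

section \<open>Possible symmetries in the absence of order two symmetries\<close>

lemma no_order_two_symmetryD:
  assumes "\<nexists>g. order_two_symmetry g P" "norm n = 1"
  shows "tensor_act (rot n pi) P \<noteq> P" "tensor_act (- rot n pi) P \<noteq> P"
  using assms unfolding order_two_symmetry_def plane_reflection_def by blast+

lemma cos_rot_symmetry:
  assumes "\<nexists>g. order_two_symmetry g P" "norm n = 1" "tensor_act (rot n \<theta>) P = P"
  shows "cos \<theta> = 1 \<or> cos \<theta> = -1/2"
  using rot_pi_fixes[OF assms(2,3)] no_order_two_symmetryD(1)[OF assms(1,2)] by blast

lemma det_symmetry:
  assumes no2: "\<nexists>g. order_two_symmetry g P" and g: "g \<in> symmetry_group P"
  shows "det g = 1"
proof (rule ccontr)
  assume "det g \<noteq> 1"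
  moreover have o: "orthogonal_matrix g" using g by (simp add: mem_symmetry_group)
  ultimately have "det g = - 1" using det_orthogonal_matrix by blast
  then have "rotation_matrix (- g)"
    using o by (simp add: rotation_matrix_def orthogonal_matrix_def transpose_def vec_eq_iff
        matrix_matrix_mult_def sum_3 det_3)
  then obtain n \<theta> where n: "norm n = 1" and r: "- g = rot n \<theta>" by (rule rotation_matrix_eq_rot)
  \<comment> \<open>The order of the tensor is odd, so -1 acts as negation.\<close>
  have fP: "tensor_act (rot n \<theta>) P = - P"
    using g r tensor_act_uminus[of g P] by (simp add: mem_symmetry_group)
  have neg: "tensor_act A (- P) = - tensor_act A P" for A
    by (simp add: tensor_act_def vec_eq_iff sum_negf)
  have "tensor_act (rot n (\<theta> + \<theta>)) P = P"
    unfolding rot_add[OF n, symmetric] tensor_act_mul fP neg by simp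
  then have "cos (2 * \<theta>) = 1 \<or> cos (2 * \<theta>) = -1/2"
    using cos_rot_symmetry[OF no2 n] by simp
  \<comment> \<open>Both 1 and -1/2 are roots of 4x^3 - 3x = 1. Hence the rotation by 3\<theta> is
    the identity or the half-turn, and it still sends \<open>P\<close> to
    \<open>- P\<close>.\<close>
  then have "cos (3 * (2 * \<theta>)) = 1" unfolding cos_treble_cos by (auto simp: power_divide)
  then have s: "sin (3 * \<theta>) = 0" using cos_double_sin[of "3 * \<theta>"] by (simp add: mult.left_commute)
  have "tensor_act (rot n (\<theta> + \<theta> + \<theta>)) P = - P"
    unfolding rot_add[OF n, symmetric] tensor_act_mul fP neg by simp
  then have f3: "tensor_act (rot n (3 * \<theta>)) P = - P" by (simp add: algebra_simps)
  have "cos (3 * \<theta>) = 1 \<or> cos (3 * \<theta>) = - 1"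
    using sin_cos_squared_add[of "3 * \<theta>"] s by (simp add: power2_eq_1_iff)
  then show False
  proof
    assume "cos (3 * \<theta>) = 1"
    then have "P = - P" using f3 s by (simp add: rot_eq_mat1 tensor_act_mat1)
    then have "P = 0" by (simp add: vec_eq_iff)
    then have "tensor_act (rot n pi) P = P" by (simp add: tensor_act_def vec_eq_iff)
    then show False using no_order_two_symmetryD(1)[OF no2 n] by blast
  next
    assume "cos (3 * \<theta>) = - 1"
    then have "rot n (3 * \<theta>) = rot n pi" using s by (simp add: rot_def)
    then have "tensor_act (- rot n pi) P = P" using f3 by (simp add: tensor_act_uminus)
    then show False using no_order_two_symmetryD(2)[OF no2 n] by blast
  qed
qed

lemma symmetry_eq_mat1_or_rot_120:
  assumes no2: "\<nexists>g. order_two_symmetry g P" and g: "g \<in> symmetry_group P"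
  shows "g = mat 1 \<or> (\<exists>n. norm n = 1 \<and> g = rot n (2 * pi / 3))"
proof -
  have "rotation_matrix g"
    using det_symmetry[OF no2 g] g by (simp add: rotation_matrix_def mem_symmetry_group)
  then obtain n \<theta> where n: "norm n = 1" and r: "g = rot n \<theta>" by (rule rotation_matrix_eq_rot)
  have "cos \<theta> = 1 \<or> cos \<theta> = -1/2"
    using cos_rot_symmetry[OF no2 n] g r by (simp add: mem_symmetry_group)
  then show ?thesis
  proof
    assume c: "cos \<theta> = 1"
    then have "sin \<theta> = 0" using sin_cos_squared_add[of \<theta>] by simp
    then show ?thesis using c r by (simp add: rot_eq_mat1)
  next
    assume c: "cos \<theta> = -1/2"
    have "(sin \<theta>)\<^sup>2 = 1 - (cos \<theta>)\<^sup>2" by (rule sin_squared_eq)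
    also have "\<dots> = (sqrt 3 / 2)\<^sup>2" by (simp add: c power_divide)
    finally consider "sin \<theta> = sqrt 3 / 2" | "sin \<theta> = - (sqrt 3 / 2)"
      by (auto simp: power2_eq_iff)
    then show ?thesis
    proof cases
      case 1
      then have "g = rot n (2 * pi / 3)" using c by (simp only: r rot_def cos_120 sin_120)
      then show ?thesis using n by blast
    next
      \<comment> \<open>Here \<theta> is -2pi/3 up to full turns, so reversing the axis gives the
        angle 2pi/3.\<close>
      case 2
      then have "sin (- \<theta>) = sqrt 3 / 2" "cos (- \<theta>) = -1/2" using c by simp_all
      then have "rot n \<theta> = rot (- n) (2 * pi / 3)"
        using rot_uminus[of "- n" \<theta>] by (simp only: minus_minus rot_def cos_120 sin_120)
      then show ?thesis using n r by (metis norm_minus_cancel)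
    qed
  qed
qed

lemma trace_symmetry:
  assumes "\<nexists>g. order_two_symmetry g P" "g \<in> symmetry_group P"
  shows "trace g = 3 \<or> trace g = 0"
  using symmetry_eq_mat1_or_rot_120[OF assms] by (auto simp: trace_I trace_rot cos_120 simp del: cos_120')

section \<open>Uniqueness of the threefold axis\<close>

text \<open>The trace of the product depends only on the inner product \<open>m$3\<close> of the two
  axes. The factor 4 clears the denominators.\<close>

lemma trace_rot_120_mult:
  assumes "norm m = 1"
  shows "4 * trace (rot (axis 3 1) (2 * pi / 3) ** rot m (2 * pi / 3)) = 9 * (m$3)\<^sup>2 - 6 * m$3 - 3"
proof -
  have m: "m$1 * m$1 + m$2 * m$2 + m$3 * m$3 = 1"
    using assms by (simp add: norm_eq_1 inner_vec_def sum_3)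
  have "4 * trace (rot (axis 3 1) (2 * pi / 3) ** rot m (2 * pi / 3)) =
      9 * (m$3)\<^sup>2 - 6 * m$3 - 3 * (m$1 * m$1 + m$2 * m$2 + m$3 * m$3)"
    unfolding rot_e3 rot_eq_vector[of m] cos_120 sin_120
    by (simp add: trace_def sum_3 matrix_matrix_mult_def field_simps power2_eq_square)
  then show ?thesis by (simp add: m)
qed

lemma symmetry_group_eq_Z3:
  assumes no2: "\<nexists>g. order_two_symmetry g P"
    and fP: "tensor_act (rot (axis 3 1) (2 * pi / 3)) P = P"
  shows "symmetry_group P = Z3"
proof
  let ?R = "rot (axis 3 1) (2 * pi / 3)"
  have R: "?R \<in> symmetry_group P" using fP by (simp add: mem_symmetry_group orthogonal_rot)
  interpret subgroup "symmetry_group P" O3 by (rule subgroup_symmetry_group)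
  show "Z3 \<subseteq> symmetry_group P"
    unfolding Z3_def using R
    by (intro group.generate_subgroup_incl[OF group_O3 _ subgroup_symmetry_group]) auto
  show "symmetry_group P \<subseteq> Z3"
  proof
    fix g assume g: "g \<in> symmetry_group P"
    consider "g = mat 1" | m where "norm m = 1" "g = rot m (2 * pi / 3)"
      using symmetry_eq_mat1_or_rot_120[OF no2 g] by blast
    then show "g \<in> Z3"
    proof cases
      case 1
      then show ?thesis unfolding Z3_def using generate.one[of O3] by simp
    next
      case 2
      \<comment> \<open>The product with \<open>?R\<close> is again a symmetry, so its trace is 0 or
        3. Trace 0 gives the roots 1 and -1/3, trace 3 the roots -1 and 5/3.\<close>
      have quad: "k = 1 \<or> k = - 1/3 \<or> k = - 1 \<or> k = 5/3"
        if "norm l = 1" "rot l (2 * pi / 3) \<in> symmetry_group P" "k = l $ 3" for l :: "real^3" and k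
      proof -
        have "?R ** rot l (2 * pi / 3) \<in> symmetry_group P" using m_closed[OF R that(2)] by simp
        from trace_symmetry[OF no2 this] have "9 * k\<^sup>2 - 6 * k - 3 = 12 \<or> 9 * k\<^sup>2 - 6 * k - 3 = 0"
          using trace_rot_120_mult[OF that(1)] that(3) by auto
        moreover have "9 * k\<^sup>2 - 6 * k - 3 = 3 * ((k - 1) * (3 * k + 1))"
          "9 * k\<^sup>2 - 6 * k - 3 - 12 = 3 * ((k + 1) * (3 * k - 5))"
          by algebra+
        ultimately have "(k - 1) * (3 * k + 1) * ((k + 1) * (3 * k - 5)) = 0" by auto
        then show ?thesis by auto
      qed
      \<comment> \<open>The inverse of \<open>g\<close> has axis \<open>- m\<close>, so both
        \<open>m$3\<close> and its negative lie among the four roots; only 1 and -1 survive.\<close>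
      have "rot (- m) (2 * pi / 3) \<in> symmetry_group P"
        using m_inv_closed[OF g] 2 by (simp add: inv_O3 orthogonal_rot transpose_rot rot_uminus)
      from quad[OF 2(1) g[unfolded 2] refl] quad[OF _ this refl] 2(1)
      have m3: "m$3 = 1 \<or> m$3 = - 1" by auto
      have "m$1 * m$1 + m$2 * m$2 + m$3 * m$3 = 1"
        using 2(1) by (simp add: norm_eq_1 inner_vec_def sum_3)
      then have "m$1 * m$1 + m$2 * m$2 = 0" using m3 by auto
      then have "m$1 = 0" "m$2 = 0" by (simp_all add: sum_squares_eq_zero_iff)
      then have "m = axis 3 1 \<or> m = - axis 3 1"
        using m3 by (auto simp: vec_eq_iff forall_3 axis_def)
      then show ?thesis
      proof
        assume "m = axis 3 1"
        then show ?thesis unfolding 2 Z3_def by (intro generate.incl) simp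
      next
        assume "m = - axis 3 1"
        then have "g = inv\<^bsub>O3\<^esub> ?R" by (simp add: 2 rot_uminus inv_O3 orthogonal_rot transpose_rot)
        then show ?thesis unfolding Z3_def by (metis generate.inv insertI1)
      qed
    qed
  qed
qed

section \<open>Reduction to the third coordinate axis and conclusion\<close>

theorem lemma4p5:
  fixes P :: "real^3^3^3"
  assumes "P \<in> piez"
    and "\<not> (\<exists>g. order_two_symmetry g P)"
  shows "((\<exists>n :: real^3. norm n = 1 \<and> tensor_act (rot n (2 * pi / 3)) P = P)
            \<longrightarrow> symmetry_class P = conj_class Z3)
       \<and> (\<not> (\<exists>n :: real^3. norm n = 1 \<and> tensor_act (rot n (2 * pi / 3)) P = P)
            \<longrightarrow> symmetry_class P = conj_class {\<one>\<^bsub>O3\<^esub>})"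
proof (intro conjI impI)
  assume "\<exists>n :: real^3. norm n = 1 \<and> tensor_act (rot n (2 * pi / 3)) P = P"
  then obtain n :: "real^3" where n: "norm n = 1" and fP: "tensor_act (rot n (2 * pi / 3)) P = P"
    by blast
  obtain g where g: "rotation_matrix g" "g *v axis 3 1 = n" using rotation_to_axis[OF n] .
  then have o: "orthogonal_matrix g" by (simp add: rotation_matrix_def)
  \<comment> \<open>\<open>Q\<close> is \<open>P\<close> moved so that its threefold axis becomes
    \<open>axis 3 1\<close>; its symmetry class is that of \<open>P\<close>.\<close>
  define Q where "Q = tensor_act (transpose g) P"
  have P: "P = tensor_act g Q" by (simp add: Q_def tensor_act_transpose_cancel[OF o])
  have rotQ: "tensor_act (rot m t) Q = Q \<longleftrightarrow> tensor_act (rot (g *v m) t) P = P" for m t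
    using tensor_act_intertwine[OF o rot_intertwine[OF g(1)]] by (simp only: P)
  \<comment> \<open>Negation commutes with \<open>g\<close>, so plane reflections are transported
    like rotations and \<open>Q\<close> inherits the absence of order two symmetries.\<close>
  have "- rot (g *v m) t ** g = g ** - rot m t" for m t
  proof -
    have "- A ** g = - (A ** g)" "g ** - A = - (g ** A)" for A
      by (simp_all add: vec_eq_iff matrix_matrix_mult_def sum_negf)
    then show ?thesis by (simp only: rot_intertwine[OF g(1)])
  qed
  then have reflQ: "tensor_act (- rot m t) Q = Q \<longleftrightarrow> tensor_act (- rot (g *v m) t) P = P" for m t
    using tensor_act_intertwine[OF o] by (simp only: P)
  have "\<nexists>h. order_two_symmetry h Q"
  proof
    assume "\<exists>h. order_two_symmetry h Q"
    then obtain m where m: "norm m = 1" "tensor_act (rot m pi) Q = Q \<or> tensor_act (- rot m pi) Q = Q"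
      unfolding order_two_symmetry_def plane_reflection_def by blast
    have "norm (g *v m) = 1"
      using o m(1) by (simp add: orthogonal_transformation_matrix orthogonal_transformation_norm)
    then show False
      using m(2) no_order_two_symmetryD[OF assms(2)] unfolding rotQ reflQ by blast
  qed
  moreover have "tensor_act (rot (axis 3 1) (2 * pi / 3)) Q = Q"
    using fP by (simp only: rotQ g(2))
  ultimately have "symmetry_group Q = Z3" by (rule symmetry_group_eq_Z3)
  then show "symmetry_class P = conj_class Z3"
    by (metis P o symmetry_class_def symmetry_class_tensor_act)
next
  assume "\<nexists>n :: real^3. norm n = 1 \<and> tensor_act (rot n (2 * pi / 3)) P = P"
  then have "symmetry_group P \<subseteq> {mat 1}"
    using symmetry_eq_mat1_or_rot_120[OF assms(2)] mem_symmetry_group by blast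
  moreover have "mat 1 \<in> symmetry_group P"
    by (simp add: mem_symmetry_group orthogonal_matrix_id tensor_act_mat1)
  ultimately have "symmetry_group P = {mat 1}" by blast
  then show "symmetry_class P = conj_class {\<one>\<^bsub>O3\<^esub>}" by (simp add: symmetry_class_def)
qed
end
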